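(* Let $d\ge 2$ be even. Then the polytope $\widetilde{P}_{\partial(\sigma_{d+1})}\subseteq\mathbb{R}^d$ is completely described by the following inequalities, i.e. it is the set of all $x\in\mathbb{R}^d$ satisfying: (i) $\sum_{k=1}^d x_k\le d+2$; (ii) $\sum_{k\in[d],\,k\text{ odd}}x_k-x_i\le\frac{d+2}{2}$ for every even $i\in[d]$; (iii) $\sum_{k\in[d],\,k\text{ even}}x_k-x_j\le\frac{d+2}{2}$ for every odd $j\in[d]$; (iv) $x_i+x_j\ge0$ for all $1\le i<j\le d$ such that $i+j$ is odd. Moreover, this description is irredundant. In particular, $\widetilde{P}_{\partial(\sigma_{d+1})}$ has exactly $\frac{(d+2)^2}{4}$ facets.
   Context: Let $\sigma_{d+1}=2^{[d+2]}$ be the full simplex on vertex set $[d+2]=\{1<2<\dots<d+2\}$ and $\Delta=\partial(\sigma_{d+1})=\sigma_{d+1}\setminus\{[d+2]\}$ its boundary, a $d$-dimensional simplicial complex. The simplicial boundary map $\partial_d$ is $\partial_d(e_\sigma)=\sum_{k=1}^{d+1}(-1)^{k-1}e_{\sigma\setminus\{j_k\}}$ for a $d$-face $\sigma=\{j_1<\dots<j_{d+1}\}$, and the $d$-th Laplacian matrix is $\mathcal{L}_d(\Delta)=\partial_d^{\top}\partial_d\in\mathbb{Z}^{(d+2)\times(d+2)}$ (as $\partial_{d+1}=0$), with rows and columns ordered according to the facets $F_1,\dots,F_{d+2}$, $F_i=[d+2]\setminus\{d+3-i\}$. For $d$ even, $\widetilde{P}_{\partial(\sigma_{d+1})}\subseteq\mathbb{R}^d$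 is the convex hull of the columns of the $d\times(d+2)$-matrix obtained from $\mathcal{L}_d(\Delta)$ by deleting its first two rows. *)

theory Defs
  imports "HOL-Analysis.Analysis"
begin

text \<open>Simplicial complexes on vertices in \<^typ>\<open>nat\<close>, given as sets of faces (the empty face included).\<close>

definition faces :: "nat \<Rightarrow> nat set set \<Rightarrow> nat set set" where
  "faces k \<Delta> = {\<sigma> \<in> \<Delta>. card \<sigma> = k + 1}"

text \<open>The coefficient of \<open>e_\<tau>\<close> in \<open>\<partial> e_\<sigma> = \<Sum>k. (-1)^(k-1) e_(\<sigma> - {j_k})\<close>, where \<open>j_1 < j_2 < \<dots>\<close> are
  the vertices of \<open>\<sigma>\<close>; lists are indexed from 0, so \<open>j_k\<close> is \<open>sorted_list_of_set \<sigma> ! (k - 1)\<close>.\<close>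

definition boundary_coeff :: "nat set \<Rightarrow> nat set \<Rightarrow> int" where
  "boundary_coeff \<tau> \<sigma> =
     (\<Sum>k = 1..card \<sigma>. (-1) ^ (k - 1) * (if \<tau> = \<sigma> - {sorted_list_of_set \<sigma> ! (k - 1)} then 1 else 0))"

text \<open>The \<open>(\<sigma>, \<sigma>')\<close> entry of \<open>\<partial>\<^sub>d\<^sup>T \<partial>\<^sub>d\<close>, which is the \<open>d\<close>-th Laplacian of a \<open>d\<close>-dimensional
  complex (\<open>d \<ge> 1\<close>), since then \<open>\<partial>\<^sub>d\<^sub>+\<^sub>1 = 0\<close>.\<close>

definition laplacian_entry :: "nat \<Rightarrow> nat set set \<Rightarrow> nat set \<Rightarrow> nat set \<Rightarrow> int" where
  "laplacian_entry d \<Delta> \<sigma> \<sigma>' =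
     (\<Sum>\<tau> \<in> faces (d - 1) \<Delta>. boundary_coeff \<tau> \<sigma> * boundary_coeff \<tau> \<sigma>')"

definition simplex_boundary :: "nat \<Rightarrow> nat set set" where
  "simplex_boundary d = Pow {1..d + 2} - {{1..d + 2}}"

definition simplex_facet :: "nat \<Rightarrow> nat \<Rightarrow> nat set" where
  "simplex_facet d i = {1..d + 2} - {d + 3 - i}"

text \<open>Rows and columns are numbered \<open>1, \<dots>, d + 2\<close>.\<close>

definition laplacian_matrix :: "nat \<Rightarrow> nat \<Rightarrow> nat \<Rightarrow> int" where
  "laplacian_matrix d i j =
     laplacian_entry d (simplex_boundary d) (simplex_facet d i) (simplex_facet d j)"

text \<open>The space \<open>\<real>\<^sup>d\<close> is \<^typ>\<open>real ^ 'n\<close> together with a numbering \<open>ix\<close> of the coordinates, a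
  bijection from \<open>{1..d}\<close> onto \<^typ>\<open>'n\<close>: the \<open>k\<close>-th coordinate of \<open>x\<close> is \<open>x $ ix k\<close>.
  Row \<open>k\<close> of the matrix with the first two rows deleted is row \<open>k + 2\<close> of the Laplacian.\<close>

definition reduced_column :: "nat \<Rightarrow> (nat \<Rightarrow> 'n::finite) \<Rightarrow> nat \<Rightarrow> real ^ 'n" where
  "reduced_column d ix j =
     (\<Sum>k = 1..d. real_of_int (laplacian_matrix d (k + 2) j) *\<^sub>R axis (ix k) 1)"

definition laplacian_polytope :: "nat \<Rightarrow> (nat \<Rightarrow> 'n::finite) \<Rightarrow> (real ^ 'n) set" where
  "laplacian_polytope d ix = convex hull (reduced_column d ix ` {1..d + 2})"

text \<open>The inequalities are treated as a family with formal labels, so that irredundancy speaks about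
  removing a single member of the family, even if two members were to define the same half-space.\<close>

datatype ineq = Total | OddSum nat | EvenSum nat | PairSum nat nat

definition ineqs :: "nat \<Rightarrow> ineq set" where
  "ineqs d = {Total}
     \<union> {OddSum i | i. i \<in> {1..d} \<and> even i}
     \<union> {EvenSum j | j. j \<in> {1..d} \<and> odd j}
     \<union> {PairSum i j | i j. 1 \<le> i \<and> i < j \<and> j \<le> d \<and> odd (i + j)}"

fun satisfies :: "nat \<Rightarrow> (nat \<Rightarrow> 'n::finite) \<Rightarrow> real ^ 'n \<Rightarrow> ineq \<Rightarrow> bool" where
  "satisfies d ix x Total \<longleftrightarrow> (\<Sum>k = 1..d. x $ ix k) \<le> real d + 2"
| "satisfies d ix x (OddSum i) \<longleftrightarrow>
     (\<Sum>k \<in> {k \<in> {1..d}. odd k}. x $ ix k) - x $ ix i \<le> (real d + 2) / 2"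
| "satisfies d ix x (EvenSum j) \<longleftrightarrow>
     (\<Sum>k \<in> {k \<in> {1..d}. even k}. x $ ix k) - x $ ix j \<le> (real d + 2) / 2"
| "satisfies d ix x (PairSum i j) \<longleftrightarrow> 0 \<le> x $ ix i + x $ ix j"

definition solutions :: "nat \<Rightarrow> (nat \<Rightarrow> 'n::finite) \<Rightarrow> ineq set \<Rightarrow> (real ^ 'n) set" where
  "solutions d ix C = {x. \<forall>c \<in> C. satisfies d ix x c}"

lemma solutions_ineqs:
  "solutions d ix (ineqs d) =
     {x. (\<Sum>k = 1..d. x $ ix k) \<le> real d + 2
       \<and> (\<forall>i \<in> {1..d}. even i \<longrightarrow>
            (\<Sum>k \<in> {k \<in> {1..d}. odd k}. x $ ix k) - x $ ix i \<le> (real d + 2) / 2)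
       \<and> (\<forall>j \<in> {1..d}. odd j \<longrightarrow>
            (\<Sum>k \<in> {k \<in> {1..d}. even k}. x $ ix k) - x $ ix j \<le> (real d + 2) / 2)
       \<and> (\<forall>i j. 1 \<le> i \<and> i < j \<and> j \<le> d \<and> odd (i + j) \<longrightarrow> 0 \<le> x $ ix i + x $ ix j)}"
proof -
  have *: "(\<forall>c \<in> {f i | i. P i}. Q c) \<longleftrightarrow> (\<forall>i. P i \<longrightarrow> Q (f i))"
    and **: "(\<forall>c \<in> {g i j | i j. R i j}. Q c) \<longleftrightarrow> (\<forall>i j. R i j \<longrightarrow> Q (g i j))"
    for f :: "nat \<Rightarrow> ineq" and g :: "nat \<Rightarrow> nat \<Rightarrow> ineq" and P R Q
    by blast+
  show ?thesis
    unfolding solutions_def ineqs_def ball_Un * ** by (simp add: imp_conjL conj_assoc Ball_def)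
qed

end

theory Submission
  imports Defs
begin

text \<open>The Laplacian of the boundary of the simplex is \<open>(d + 2) I - s s\<^sup>T\<close> with \<open>s\<^sub>i = (-1)\<^sup>i\<close>. Hence
  the polytope is a free sum of two simplices of dimension \<open>d / 2\<close>: the odd-numbered and the
  even-numbered columns have the same barycentre, and this is the only affine dependence among the
  \<open>d + 2\<close> columns. Writing \<open>x\<close> as an affine combination of the columns, with coefficients
  \<open>w\<^sub>l(x) / (d + 2)\<close> normalized so that either parity class contributes \<open>1/2\<close>, all other
  affine combinations arise by adding \<open>t\<close> on one class and subtracting it on the other. So \<open>x\<close> lies in
  the polytope iff \<open>w\<^sub>i(x) + w\<^sub>j(x) \<ge> 0\<close> for all odd \<open>i\<close> and even \<open>j\<close>; since \<open>w\<^sub>k\<^sub>+\<^sub>2(x) = x\<^sub>k\<close>, these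
  are the stated inequalities, and the facet of \<open>(i, j)\<close> contains all columns except the
  \<open>i\<close>-th and the \<open>j\<close>-th.\<close>

section \<open>Boundary coefficients and the Laplacian of the simplex boundary\<close>

text \<open>The position of a vertex in the sorted list is the number of smaller vertices of
  \<open>\<sigma>\<close>. Indexing by vertices removes the list from all later sign
  computations.\<close>

lemma boundary_coeff_eq_sum:
  assumes "finite \<sigma>"
  shows "boundary_coeff \<tau> \<sigma> =
    (\<Sum>v\<in>\<sigma>. if \<tau> = \<sigma> - {v} then (-1) ^ card {x \<in> \<sigma>. x < v} else 0)"
proof -
  define xs where "xs = sorted_list_of_set \<sigma>"
  have xs: "sorted_wrt (<) xs" "distinct xs" "set xs = \<sigma>" "length xs = card \<sigma>"
    using assms by (simp_all add: xs_def)
  have bij: "bij_betw (\<lambda>k. xs ! k) {..<card \<sigma>} \<sigma>"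
    using xs by (intro bij_betw_nth) auto
  have lt: "xs ! p < xs ! q \<longleftrightarrow> p < q" if "p < card \<sigma>" "q < card \<sigma>" for p q
    using that xs sorted_wrt_nth_less[OF xs(1)]
    by (metis linorder_neqE_nat order_less_asym order_less_irrefl)
  have card_below: "card {x \<in> \<sigma>. x < xs ! p} = p" if "p < card \<sigma>" for p
  proof -
    have "{x \<in> \<sigma>. x < xs ! p} = (\<lambda>k. xs ! k) ` {..<p}"
    proof (intro equalityI subsetI)
      fix x assume x: "x \<in> {x \<in> \<sigma>. x < xs ! p}"
      then obtain q where "q < card \<sigma>" "x = xs ! q"
        using xs by (metis (mono_tags, lifting) in_set_conv_nth mem_Collect_eq)
      then show "x \<in> (\<lambda>k. xs ! k) ` {..<p}" using x lt that by auto
    next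
      fix x assume "x \<in> (\<lambda>k. xs ! k) ` {..<p}"
      then show "x \<in> {x \<in> \<sigma>. x < xs ! p}" using that lt xs nth_mem by fastforce
    qed
    moreover have "inj_on (\<lambda>k. xs ! k) {..<p}"
      using bij that by (auto simp: bij_betw_def intro: inj_on_subset)
    ultimately show ?thesis by (simp add: card_image)
  qed
  have "boundary_coeff \<tau> \<sigma> = (\<Sum>k<card \<sigma>. (-1) ^ k * (if \<tau> = \<sigma> - {xs ! k} then 1 else 0))"
    unfolding boundary_coeff_def xs_def
    by (rule sum.reindex_bij_witness[of _ Suc "\<lambda>k. k - 1"]) auto
  also have "\<dots> = (\<Sum>k<card \<sigma>. if \<tau> = \<sigma> - {xs ! k} then (-1) ^ card {x \<in> \<sigma>. x < xs ! k} else 0)"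
    by (intro sum.cong) (auto simp: card_below)
  also have "\<dots> = (\<Sum>v\<in>\<sigma>. if \<tau> = \<sigma> - {v} then (-1) ^ card {x \<in> \<sigma>. x < v} else 0)"
    by (rule sum.reindex_bij_betw[OF bij])
  finally show ?thesis .
qed

lemma boundary_coeff_codim1:
  assumes "finite \<sigma>" "v \<in> \<sigma>"
  shows "boundary_coeff (\<sigma> - {v}) \<sigma> = (-1) ^ card {x \<in> \<sigma>. x < v}"
proof -
  have "\<sigma> - {v} = \<sigma> - {u} \<longleftrightarrow> v = u" if "u \<in> \<sigma>" for u
    using assms that by blast
  then have "boundary_coeff (\<sigma> - {v}) \<sigma> =
      (\<Sum>u\<in>\<sigma>. if v = u then (-1) ^ card {x \<in> \<sigma>. x < u} else 0)"
    unfolding boundary_coeff_eq_sum[OF assms(1)] by (intro sum.cong) auto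
  then show ?thesis using assms by simp
qed

lemma boundary_coeff_eq_0:
  assumes "finite \<sigma>" "\<nexists>v. v \<in> \<sigma> \<and> \<tau> = \<sigma> - {v}"
  shows "boundary_coeff \<tau> \<sigma> = 0"
  unfolding boundary_coeff_eq_sum[OF assms(1)] using assms(2) by (intro sum.neutral) auto

lemma codim2_in_faces:
  assumes "d \<ge> 1" "a \<in> {1..d + 2}" "v \<in> {1..d + 2} - {a}"
  shows "{1..d + 2} - {a} - {v} \<in> faces (d - 1) (simplex_boundary d)"
proof -
  have "card ({1..d + 2} - {a} - {v}) = d" using assms by simp
  moreover have "{1..d + 2} - {a} - {v} \<noteq> {1..d + 2}" using assms(2) by blast
  ultimately show ?thesis
    using assms(1) unfolding faces_def simplex_boundary_def by force
qed

text \<open>Only the \<open>d + 1\<close> ridges of the facet itself contribute, each with the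
  square of a sign.\<close>

lemma laplacian_entry_simplex_boundary_diag:
  assumes "d \<ge> 1" "a \<in> {1..d + 2}"
  shows "laplacian_entry d (simplex_boundary d) ({1..d + 2} - {a}) ({1..d + 2} - {a}) = int d + 1"
proof -
  define \<sigma> where "\<sigma> = {1..d + 2} - {a}"
  have fin: "finite \<sigma>" and card: "card \<sigma> = d + 1" using assms by (auto simp: \<sigma>_def)
  have "laplacian_entry d (simplex_boundary d) \<sigma> \<sigma> =
      (\<Sum>\<tau> \<in> (\<lambda>v. \<sigma> - {v}) ` \<sigma>. boundary_coeff \<tau> \<sigma> * boundary_coeff \<tau> \<sigma>)"
    unfolding laplacian_entry_def
  proof (rule sum.mono_neutral_right)
    show "finite (faces (d - 1) (simplex_boundary d))"
      by (simp add: faces_def simplex_boundary_def)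
    show "(\<lambda>v. \<sigma> - {v}) ` \<sigma> \<subseteq> faces (d - 1) (simplex_boundary d)"
      unfolding \<sigma>_def by (rule image_subsetI) (rule codim2_in_faces[OF assms])
    show "\<forall>\<tau>\<in>faces (d - 1) (simplex_boundary d) - (\<lambda>v. \<sigma> - {v}) ` \<sigma>.
       boundary_coeff \<tau> \<sigma> * boundary_coeff \<tau> \<sigma> = 0"
    proof
      fix \<tau> assume "\<tau> \<in> faces (d - 1) (simplex_boundary d) - (\<lambda>v. \<sigma> - {v}) ` \<sigma>"
      then have "boundary_coeff \<tau> \<sigma> = 0" by (intro boundary_coeff_eq_0[OF fin]) blast
      then show "boundary_coeff \<tau> \<sigma> * boundary_coeff \<tau> \<sigma> = 0" by simp
    qed
  qed
  also have "\<dots> = (\<Sum>v\<in>\<sigma>. boundary_coeff (\<sigma> - {v}) \<sigma> * boundary_coeff (\<sigma> - {v}) \<sigma>)"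
    by (subst sum.reindex) (auto simp: inj_on_def)
  also have "\<dots> = (\<Sum>v\<in>\<sigma>. 1)"
    by (intro sum.cong refl) (simp add: boundary_coeff_codim1[OF fin] flip: power_add)
  finally have "laplacian_entry d (simplex_boundary d) \<sigma> \<sigma> = int d + 1" by (simp add: card)
  then show ?thesis by (simp only: \<sigma>_def)
qed

text \<open>Two distinct facets share exactly one ridge, the one that omits both \<open>a\<close>
  and \<open>b\<close>, so a single product of signs survives.\<close>

lemma laplacian_entry_simplex_boundary_less:
  assumes "d \<ge> 1" "a < b" "a \<in> {1..d + 2}" "b \<in> {1..d + 2}"
  shows "laplacian_entry d (simplex_boundary d) ({1..d + 2} - {a}) ({1..d + 2} - {b}) =
    - ((-1) ^ (a + b))"
    and "laplacian_entry d (simplex_boundary d) ({1..d + 2} - {b}) ({1..d + 2} - {a}) =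
    - ((-1) ^ (a + b))"
proof -
  define \<sigma> \<rho> where "\<sigma> = {1..d + 2} - {a}" and "\<rho> = {1..d + 2} - {b}"
  have fin: "finite \<sigma>" "finite \<rho>" by (auto simp: \<sigma>_def \<rho>_def)
  have b: "boundary_coeff (\<sigma> - {b}) \<sigma> = (-1) ^ b"
  proof -
    \<comment> \<open>The smaller vertex \<open>a\<close> is missing below \<open>b\<close>, whereas
      nothing is missing below \<open>a\<close> in \<open>\<rho>\<close>. This asymmetry produces
      the minus sign.\<close>
    have "{x \<in> \<sigma>. x < b} = {1..<b} - {a}" using assms by (auto simp: \<sigma>_def)
    then have "card {x \<in> \<sigma>. x < b} = b - 2" using assms by simp
    moreover have "b = Suc (Suc (b - 2))" using assms by auto
    then have "(-1 :: int) ^ (b - 2) = (-1) ^ b"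
      by (metis add.inverse_inverse mult_minus1 power_Suc)
    ultimately show ?thesis
      using assms boundary_coeff_codim1[OF fin(1), of b] by (simp add: \<sigma>_def)
  qed
  have a: "boundary_coeff (\<sigma> - {b}) \<rho> = - ((-1) ^ a)"
  proof -
    have "{x \<in> \<rho>. x < a} = {1..<a}" using assms by (auto simp: \<rho>_def)
    then have "card {x \<in> \<rho>. x < a} = a - 1" using assms by simp
    moreover have "a = Suc (a - 1)" using assms by auto
    then have "(-1 :: int) ^ (a - 1) = - ((-1) ^ a)"
      by (metis add.inverse_inverse mult_minus1 power_Suc)
    moreover have "\<sigma> - {b} = \<rho> - {a}" by (auto simp: \<sigma>_def \<rho>_def)
    ultimately show ?thesis
      using assms boundary_coeff_codim1[OF fin(2), of a] by (simp add: \<rho>_def)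
  qed
  have "laplacian_entry d (simplex_boundary d) \<sigma> \<rho> =
      (\<Sum>\<tau> \<in> {\<sigma> - {b}}. boundary_coeff \<tau> \<sigma> * boundary_coeff \<tau> \<rho>)"
    unfolding laplacian_entry_def
  proof (rule sum.mono_neutral_right)
    show "finite (faces (d - 1) (simplex_boundary d))"
      by (simp add: faces_def simplex_boundary_def)
    show "{\<sigma> - {b}} \<subseteq> faces (d - 1) (simplex_boundary d)"
      using codim2_in_faces[of d a b] assms by (simp add: \<sigma>_def)
    show "\<forall>\<tau>\<in>faces (d - 1) (simplex_boundary d) - {\<sigma> - {b}}.
       boundary_coeff \<tau> \<sigma> * boundary_coeff \<tau> \<rho> = 0"
    proof (rule ballI, rule ccontr)
      fix \<tau> assume \<tau>: "\<tau> \<in> faces (d - 1) (simplex_boundary d) - {\<sigma> - {b}}"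
        "boundary_coeff \<tau> \<sigma> * boundary_coeff \<tau> \<rho> \<noteq> 0"
      from \<tau>(2) have "boundary_coeff \<tau> \<sigma> \<noteq> 0" "boundary_coeff \<tau> \<rho> \<noteq> 0" by simp_all
      with boundary_coeff_eq_0[OF fin(1), of \<tau>] boundary_coeff_eq_0[OF fin(2), of \<tau>]
      obtain v u where "\<tau> = \<sigma> - {v}" "\<tau> = \<rho> - {u}" by blast
      moreover have "b \<in> \<sigma>" "b \<notin> \<rho>" using assms by (simp_all add: \<sigma>_def \<rho>_def)
      ultimately have "v = b" by blast
      then show False using \<tau> \<open>\<tau> = \<sigma> - {v}\<close> by simp
    qed
  qed
  also have "\<dots> = - ((-1) ^ (a + b))" by (simp add: a b power_add)
  finally show "laplacian_entry d (simplex_boundary d) ({1..d + 2} - {a}) ({1..d + 2} - {b}) =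
    - ((-1) ^ (a + b))" by (simp add: \<sigma>_def \<rho>_def)
  then show "laplacian_entry d (simplex_boundary d) ({1..d + 2} - {b}) ({1..d + 2} - {a}) =
    - ((-1) ^ (a + b))" by (simp add: laplacian_entry_def mult.commute)
qed

lemma laplacian_matrix_eq:
  assumes "d \<ge> 1" "i \<in> {1..d + 2}" "j \<in> {1..d + 2}"
  shows "laplacian_matrix d i j = (if i = j then int d + 2 else 0) - (-1) ^ (i + j)"
proof -
  define a b where "a = d + 3 - i" and "b = d + 3 - j"
  have ab: "a \<in> {1..d + 2}" "b \<in> {1..d + 2}" using assms by (auto simp: a_def b_def)
  \<comment> \<open>The facet numbering reverses the order of the omitted vertices, but the parity
    of the index sum, and with it the sign, is unchanged.\<close>
  have *: "a + b + (i + j) = 2 * (d + 3)" using assms by (auto simp: a_def b_def)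
  have "even (a + b) \<longleftrightarrow> even (i + j)" using arg_cong[OF *, of even] by simp
  then have sgn: "(-1 :: int) ^ (a + b) = (-1) ^ (i + j)"
    by (metis neg_one_even_power neg_one_odd_power)
  consider "i = j" | "a < b" "i \<noteq> j" | "b < a" "i \<noteq> j"
    using assms by (force simp: a_def b_def)
  then show ?thesis
  proof cases
    case 1
    then show ?thesis
      using laplacian_entry_simplex_boundary_diag[OF assms(1) ab(1)]
      by (simp add: laplacian_matrix_def simplex_facet_def a_def)
  next
    case 2
    then show ?thesis
      using laplacian_entry_simplex_boundary_less(1)[OF assms(1) _ ab] sgn
      by (simp add: laplacian_matrix_def simplex_facet_def a_def b_def)
  next
    case 3
    then show ?thesis
      using laplacian_entry_simplex_boundary_less(2)[OF assms(1) _ ab(2,1)] sgn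
      by (simp add: laplacian_matrix_def simplex_facet_def a_def b_def add.commute)
  qed
qed


section \<open>Sums over indices and parity classes\<close>

lemma sum_neg_one_power_even:
  assumes "even n"
  shows "(\<Sum>l = 1..n. (-1) ^ l) = (0 :: 'a :: comm_ring_1)"
proof -
  obtain m where "n = 2 * m" using assms by blast
  moreover have "(\<Sum>l = 1..2 * m. (-1) ^ l) = (0 :: 'a)" by (induction m) auto
  ultimately show ?thesis by simp
qed

lemma sum_shift2:
  fixes f :: "nat \<Rightarrow> 'a :: comm_monoid_add"
  shows "(\<Sum>l = 1..d + 2. f l) = f 1 + f 2 + (\<Sum>k = 1..d. f (k + 2))"
  by (induction d) (simp_all add: add_ac numeral_2_eq_2)

text \<open>The classes are written through their representatives \<open>1\<close> and
  \<open>2\<close>, so that both summands are literal instances of \<open>sum_class\<close>.\<close>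

lemma sum_split_parity:
  fixes f :: "nat \<Rightarrow> 'a :: comm_monoid_add"
  shows "(\<Sum>l = 1..n. f l) = (\<Sum>l \<in> {l \<in> {1..n::nat}. odd l = odd (1::nat)}. f l) +
     (\<Sum>l \<in> {l \<in> {1..n}. odd l = odd (2::nat)}. f l)"
  by (subst sum.union_disjoint[symmetric]) (auto intro: sum.cong)

section \<open>Weights as affine coordinates with respect to the columns\<close>

locale numbered_space =
  fixes d :: nat and ix :: "nat \<Rightarrow> 'n::finite"
  assumes d_ge: "d \<ge> 2" and d_even: "even d"
    and ix_bij: "bij_betw ix {1..d} (UNIV :: 'n set)"
begin

abbreviation col :: "nat \<Rightarrow> real ^ 'n" where
  "col \<equiv> reduced_column d ix"

text \<open>The unique affine extension of \<open>w\<^sub>k\<^sub>+\<^sub>2(x) = x\<^sub>k\<close> for which the odd-indexed and the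
  even-indexed values both add up to \<open>(d + 2) / 2\<close>.\<close>

definition weight :: "nat \<Rightarrow> real ^ 'n \<Rightarrow> real" where
  "weight i x = (if i \<le> 2 then (real d + 2) / 2 - (\<Sum>k \<in> {k \<in> {1..d}. odd k = odd i}. x $ ix k)
     else x $ ix (i - 2))"

text \<open>The linear part of the affine function \<open>weight i\<close>, which brings
  \<open>half\<close> into the normal form of a closed half-space.\<close>

definition grad :: "nat \<Rightarrow> real ^ 'n" where
  "grad i = (if i \<le> 2 then - (\<Sum>k \<in> {k \<in> {1..d}. odd k = odd i}. axis (ix k) 1)
     else axis (ix (i - 2)) 1)"

definition pairs :: "(nat \<times> nat) set" where
  "pairs = {(i, j). i \<in> {1..d + 2} \<and> odd i \<and> j \<in> {1..d + 2} \<and> even j}"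

definition half :: "nat \<times> nat \<Rightarrow> (real ^ 'n) set" where
  "half p = {x. 0 \<le> weight (fst p) x + weight (snd p) x}"

lemma weight_eq: "weight i x = weight i 0 + grad i \<bullet> x"
  by (simp add: weight_def grad_def inner_sum_left inner_axis' sum_negf)

lemma weight_shift [simp]: "k \<ge> 1 \<Longrightarrow> weight (k + 2) x = x $ ix k"
  by (simp add: weight_def)

lemma ix_eq_iff: "k \<in> {1..d} \<Longrightarrow> l \<in> {1..d} \<Longrightarrow> ix k = ix l \<longleftrightarrow> k = l"
  using inj_on_eq_iff[OF bij_betw_imp_inj_on[OF ix_bij]] .

lemma vec_eqI:
  assumes "\<And>k. k \<in> {1..d} \<Longrightarrow> x $ ix k = y $ ix k"
  shows "x = y"
  unfolding vec_eq_iff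
proof
  fix i
  have "i \<in> ix ` {1..d}" unfolding bij_betw_imp_surj_on[OF ix_bij] by (rule UNIV_I)
  then show "x $ i = y $ i" using assms by (elim imageE) simp
qed

lemma obtain_vec:
  obtains x :: "real ^ 'n" where "\<And>k. k \<in> {1..d} \<Longrightarrow> x $ ix k = f k"
proof
  fix k assume k: "k \<in> {1..d}"
  show "(\<chi> i. f (inv_into {1..d} ix i)) $ ix k = f k"
    by (simp only: vec_lambda_beta bij_betw_inv_into_left[OF ix_bij k])
qed

lemma col_nth:
  assumes "k \<in> {1..d}" "j \<in> {1..d + 2}"
  shows "col j $ ix k = (if j = k + 2 then real d + 2 else 0) - (-1) ^ k * (-1) ^ j"
proof -
  have "col j $ ix k = (\<Sum>l = 1..d. if l = k then real_of_int (laplacian_matrix d (l + 2) j) else 0)"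
    unfolding reduced_column_def sum_component
  proof (rule sum.cong[OF refl])
    fix l assume "l \<in> {1..d}"
    then have "ix k = ix l \<longleftrightarrow> l = k" using ix_eq_iff[OF assms(1)] by blast
    then show "(real_of_int (laplacian_matrix d (l + 2) j) *\<^sub>R axis (ix l) 1) $ ix k =
        (if l = k then real_of_int (laplacian_matrix d (l + 2) j) else 0)"
      by (simp only: vector_scaleR_component axis_def vec_lambda_beta) simp
  qed
  also have "\<dots> = real_of_int (laplacian_matrix d (k + 2) j)" using assms by simp
  also have "\<dots> = (if j = k + 2 then real d + 2 else 0) - (-1) ^ k * (-1) ^ j"
    using laplacian_matrix_eq[of d "k + 2" j] d_ge assms by (simp add: power_add)
  finally show ?thesis .
qed

text \<open>The first weight of each class is by definition what the remaining ones lack to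
  \<open>(d + 2) / 2\<close>.\<close>

lemma sum_class:
  assumes "i \<in> {1, 2 :: nat}"
  shows "(\<Sum>l \<in> {l \<in> {1..d + 2}. odd l = odd i}. weight l x) = (real d + 2) / 2"
proof -
  have "(\<Sum>l \<in> {l \<in> {1..d + 2}. odd l = odd i}. weight l x)
      = (\<Sum>l = 1..d + 2. if odd l = odd i then weight l x else 0)"
    by (rule sum.inter_filter) simp
  also have "\<dots> = weight i x + (\<Sum>k = 1..d. if odd k = odd i then weight (k + 2) x else 0)"
    unfolding sum_shift2 using assms by auto
  also have "(\<Sum>k = 1..d. if odd k = odd i then weight (k + 2) x else 0) =
     (\<Sum>k = 1..d. if odd k = odd i then x $ ix k else 0)"
    \<comment> \<open>Without the deletion \<open>k + 2\<close> becomes \<open>Suc (Suc k)\<close>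
      and \<open>weight_shift\<close> no longer matches.\<close>
    by (intro sum.cong) (auto simp del: add_2_eq_Suc')
  also have "\<dots> = (\<Sum>k \<in> {k \<in> {1..d}. odd k = odd i}. x $ ix k)"
    by (rule sum.inter_filter[symmetric]) simp
  finally show ?thesis using assms by (auto simp: weight_def)
qed

lemma sum_weight: "(\<Sum>l = 1..d + 2. weight l x) = real d + 2"
  unfolding sum_split_parity using sum_class[of 1 x] sum_class[of 2 x] by simp

lemma alternating_sum_weight: "(\<Sum>l = 1..d + 2. (-1) ^ l * weight l x) = 0"
proof -
  have "(\<Sum>l = 1..d + 2. (-1) ^ l * weight l x) =
    (\<Sum>l \<in> {l \<in> {1..d + 2}. odd l = odd (1::nat)}. - weight l x) +
     (\<Sum>l \<in> {l \<in> {1..d + 2}. odd l = odd (2::nat)}. weight l x)"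
    unfolding sum_split_parity by (intro arg_cong2[of _ _ _ _ "(+)"] sum.cong) auto
  then show ?thesis using sum_class[of 1 x] sum_class[of 2 x] by (simp add: sum_negf)
qed

lemma alternating_sum_one: "(\<Sum>l = 1..d + 2. (-1) ^ l) = (0 :: real)"
  using sum_neg_one_power_even d_even by simp

text \<open>The free parameter \<open>t\<close> reflects the affine dependence among the columns: the odd-indexed and
  the even-indexed ones have the same barycentre.\<close>

lemma columns_combination:
  "x = (\<Sum>l = 1..d + 2. ((weight l x + (-1) ^ l * t) / (real d + 2)) *\<^sub>R col l)"
proof (rule vec_eqI)
  fix k assume k: "k \<in> {1..d}"
  let ?N = "real d + 2"
  \<comment> \<open>The diagonal part of the Laplacian selects \<open>l = k + 2\<close>. The
    rank-one part multiplies each coefficient by a further \<open>(-1) ^ l\<close>, which makes the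
    contribution of \<open>t\<close> constant in \<open>l\<close>.\<close>
  have "(\<Sum>l = 1..d + 2. ((weight l x + (-1) ^ l * t) / ?N) *\<^sub>R col l) $ ix k
    = (\<Sum>l = 1..d + 2. (if l = k + 2 then weight l x + (-1) ^ l * t else 0)
        - (-1) ^ k / ?N * ((-1) ^ l * weight l x + t))"
    unfolding sum_component
  proof (rule sum.cong[OF refl])
    fix l assume "l \<in> {1..d + 2}"
    moreover have "(-1 :: real) ^ l * (-1) ^ l = 1" by (simp flip: power_add mult_2)
    ultimately show "(((weight l x + (-1) ^ l * t) / ?N) *\<^sub>R col l) $ ix k =
        (if l = k + 2 then weight l x + (-1) ^ l * t else 0)
          - (-1) ^ k / ?N * ((-1) ^ l * weight l x + t)"
      using k by (cases "even l"; cases "even k") (auto simp: col_nth field_simps)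
  qed
  \<comment> \<open>The alternating sum of the weights vanishes, and the \<open>d + 2\<close> copies
    of \<open>t\<close> cancel the \<open>t\<close> from the diagonal part.\<close>
  also have "\<dots> = weight (k + 2) x + (-1) ^ k * t - (-1) ^ k / ?N * (0 + ?N * t)"
  proof -
    have "(\<Sum>l = 1..d + 2. if l = k + 2 then weight l x + (-1) ^ l * t else 0)
        = weight (k + 2) x + (-1) ^ k * t"
      using k by (simp add: power_add)
    moreover have "(\<Sum>l = 1..d + 2. t) = ?N * t" by simp
    ultimately show ?thesis
      by (simp only: sum_subtractf sum_distrib_left[symmetric] sum.distrib alternating_sum_weight)
  qed
  also have "\<dots> = x $ ix k" using k weight_shift[of k x] by simp
  finally show "x $ ix k = (\<Sum>l = 1..d + 2. ((weight l x + (-1) ^ l * t) / ?N) *\<^sub>R col l) $ ix k"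
    by simp
qed

text \<open>The weights of a column recover the whole Laplacian column, the two deleted rows
  included, because that column satisfies both linear relations that the weights satisfy.\<close>

lemma weight_col:
  assumes "i \<in> {1..d + 2}" "j \<in> {1..d + 2}"
  shows "weight i (col j) = (if i = j then real d + 2 else 0) - (-1) ^ i * (-1) ^ j"
proof (cases "i \<le> 2")
  case False
  then obtain k where "i = k + 2" "k \<in> {1..d}"
    using assms by (intro that[of "i - 2"]) auto
  then show ?thesis using assms by (auto simp: col_nth power_add simp del: add_2_eq_Suc')
next
  case True
  \<comment> \<open>\<open>f\<close> is the full \<open>j\<close>-th Laplacian column.\<close>
  define f where "f l = (if l = j then real d + 2 else 0) - (-1) ^ l * (-1) ^ j" for l
  define D where "D l = f l - weight l (col j)" for l
  have "D (k + 2) = 0" if "k \<in> {1..d}" for k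
    using that assms by (auto simp: D_def f_def col_nth power_add simp del: add_2_eq_Suc')
  then have D: "(\<Sum>k = 1..d. D (k + 2)) = 0" "(\<Sum>k = 1..d. (-1) ^ (k + 2) * D (k + 2)) = 0"
    by (simp_all del: add_2_eq_Suc')
  have "(\<Sum>l = 1..d + 2. f l) = real d + 2"
    unfolding f_def sum_subtractf sum_distrib_right[symmetric] alternating_sum_one using assms by simp
  then have 1: "(\<Sum>l = 1..d + 2. D l) = 0"
    by (simp only: D_def sum_subtractf sum_weight diff_self)
  have "(\<Sum>l = 1..d + 2. (-1) ^ l * f l)
      = (\<Sum>l = 1..d + 2. (if l = j then (-1) ^ j * (real d + 2) else 0) - (-1) ^ j)"
  proof (rule sum.cong[OF refl])
    fix l
    show "(-1) ^ l * f l = (if l = j then (-1) ^ j * (real d + 2) else 0) - (-1) ^ j"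
      by (cases "even l"; cases "even j") (auto simp: f_def)
  qed
  also have "\<dots> = 0" using assms by (simp add: sum_subtractf)
  finally have "(\<Sum>l = 1..d + 2. (-1) ^ l * D l) = 0"
    by (simp only: D_def sum_subtractf alternating_sum_weight right_diff_distrib diff_self)
  \<comment> \<open>\<open>D\<close> vanishes beyond index \<open>2\<close>, so the plain and the
    alternating sum give two independent equations for \<open>D 1\<close> and
    \<open>D 2\<close>.\<close>
  then have "- D 1 + D 2 = 0" and "D 1 + D 2 = 0"
    using 1 unfolding sum_shift2 D by simp_all
  moreover have "i = 1 \<or> i = 2" using True assms by auto
  ultimately have "D i = 0" by auto
  then show ?thesis by (simp add: D_def f_def)
qed


section \<open>Odd-even pairs and the half-space description of the polytope\<close>

lemma card_parity_class: "card {l \<in> {1..d + 2}. odd l = odd (1::nat)} = (d + 2) div 2" (is "card ?O = _")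
  "card {l \<in> {1..d + 2}. odd l = odd (2::nat)} = (d + 2) div 2" (is "card ?E = _")
proof -
  have "real (card ?O) + real (card ?E) = real (d + 2)"
    using sum_split_parity[of "\<lambda>_. 1 :: real" "d + 2"] by simp
  moreover have "(\<Sum>l = 1..d + 2. (-1) ^ l) =
    (\<Sum>l \<in> ?O. - 1) + (\<Sum>l \<in> ?E. 1 :: real)"
    unfolding sum_split_parity by (intro arg_cong2[of _ _ _ _ "(+)"] sum.cong) auto
  then have "real (card ?E) = real (card ?O)"
    using alternating_sum_one by simp
  ultimately show "card ?O = (d + 2) div 2" "card ?E = (d + 2) div 2" by linarith+
qed

lemma finite_pairs: "finite pairs"
  by (rule finite_subset[of _ "{1..d + 2} \<times> {1..d + 2}"]) (auto simp: pairs_def)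

lemma card_pairs: "real (card pairs) = (real d + 2)^2 / 4"
proof -
  have "pairs = {l \<in> {1..d + 2}. odd l = odd (1::nat)} \<times> {l \<in> {1..d + 2}. odd l = odd (2::nat)}"
    by (auto simp: pairs_def)
  then have "card pairs = ((d + 2) div 2) * ((d + 2) div 2)"
    by (simp only: card_cartesian_product card_parity_class)
  moreover have "real ((d + 2) div 2) = (real d + 2) / 2" using d_even by (simp add: real_of_nat_div)
  ultimately have "real (card pairs) = (real d + 2) / 2 * ((real d + 2) / 2)"
    by (simp only: of_nat_mult)
  then show ?thesis by (simp add: power2_eq_square)
qed

text \<open>For indices of opposite parity the rank-one contributions cancel. Hence the bounding
  hyperplane of \<open>half p\<close> contains every column except the two named by
  \<open>p\<close>.\<close>

lemma weight_sum_col: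
  assumes "p \<in> pairs" "l \<in> {1..d + 2}"
  shows "weight (fst p) (col l) + weight (snd p) (col l)
    = (if l = fst p \<or> l = snd p then real d + 2 else 0)"
  using assms by (auto simp: pairs_def weight_col)

lemma weight_sum_eq: "weight i x + weight j x = weight i 0 + weight j 0 + (grad i + grad j) \<bullet> x"
  using weight_eq[of i x] weight_eq[of j x] by (simp add: inner_add_left)

lemma half_eq: "half p = {x. - (grad (fst p) + grad (snd p)) \<bullet> x \<le> weight (fst p) 0 + weight (snd p) 0}"
proof (rule set_eqI)
  fix x
  show "x \<in> half p \<longleftrightarrow>
      x \<in> {x. - (grad (fst p) + grad (snd p)) \<bullet> x \<le> weight (fst p) 0 + weight (snd p) 0}"
    using weight_sum_eq[of "fst p" x "snd p"] unfolding half_def mem_Collect_eq inner_minus_left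
    by linarith
qed

lemma polytope_eq: "laplacian_polytope d ix = (\<Inter>p\<in>pairs. half p)"
proof
  show "laplacian_polytope d ix \<subseteq> (\<Inter>p\<in>pairs. half p)"
    unfolding laplacian_polytope_def
  proof (rule hull_minimal)
    show "col ` {1..d + 2} \<subseteq> (\<Inter>p\<in>pairs. half p)"
      using weight_sum_col by (auto simp: half_def)
    show "convex (\<Inter>p\<in>pairs. half p)"
      unfolding half_eq by (intro convex_INT convex_halfspace_le)
  qed
next
  show "(\<Inter>p\<in>pairs. half p) \<subseteq> laplacian_polytope d ix"
  proof
    fix x assume "x \<in> (\<Inter>p\<in>pairs. half p)"
    then have x: "weight i x + weight j x \<ge> 0"
      if "i \<in> {1..d + 2}" "odd i" "j \<in> {1..d + 2}" "even j" for i j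
      using that by (auto simp: half_def pairs_def)
    let ?W = "(\<lambda>i. weight i x) ` {i \<in> {1..d + 2}. odd i}"
    \<comment> \<open>The largest \<open>t\<close> that keeps all odd coefficients nonnegative. As
      \<open>t\<close> equals some odd weight, the even coefficients are nonnegative by the pair
      inequalities.\<close>
    define t where "t = Min ?W"
    have "finite ?W" "?W \<noteq> {}" by (auto intro: exI[of _ 1])
    from Min_in[OF this] obtain i where i: "i \<in> {1..d + 2}" "odd i" "t = weight i x"
      by (auto simp: t_def)
    have t: "t \<le> weight l x" if "l \<in> {1..d + 2}" "odd l" for l
      unfolding t_def using that by (intro Min_le) auto
    have "(\<Sum>l = 1..d + 2. ((weight l x + (-1) ^ l * t) / (real d + 2)) *\<^sub>R col l)
        \<in> laplacian_polytope d ix"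
      unfolding laplacian_polytope_def
    proof (rule convex_sum)
      have "(\<Sum>l = 1..d + 2. weight l x + (-1) ^ l * t) = real d + 2"
        unfolding sum.distrib sum_weight sum_distrib_right[symmetric] alternating_sum_one by simp
      then show "(\<Sum>l = 1..d + 2. (weight l x + (-1) ^ l * t) / (real d + 2)) = 1"
        unfolding sum_divide_distrib[symmetric] by simp
      show "0 \<le> (weight l x + (-1) ^ l * t) / (real d + 2)" if "l \<in> {1..d + 2}" for l
        using t[OF that] x[OF i(1,2) that] i(3) by (cases "even l") auto
    qed (auto intro: hull_inc)
    then show "x \<in> laplacian_polytope d ix" using columns_combination[of x t] by simp
  qed
qed

section \<open>Points with prescribed weights and irredundancy of the half-spaces\<close>

text \<open>The weights beyond index \<open>2\<close> are coordinates and can be chosen freely; the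
  first two are then forced by the class sums.\<close>

lemma obtain_weights:
  assumes f_sum: "\<And>m :: nat. m \<in> {1, 2} \<Longrightarrow> (\<Sum>l \<in> {l \<in> {1..d + 2}. odd l = odd m}. f l) = (real d + 2) / 2"
  obtains x where "\<And>l. l \<in> {1..d + 2} \<Longrightarrow> weight l x = f l"
proof -
  obtain x :: "real ^ 'n" where x: "\<And>k. k \<in> {1..d} \<Longrightarrow> x $ ix k = f (k + 2)"
    using obtain_vec[of "\<lambda>k. f (k + 2)"] by auto
  have "weight l x = f l" if "l \<in> {1..d + 2}" for l
  proof (cases "l \<le> 2")
    case False
    then have "l - 2 \<in> {1..d}" "l - 2 + 2 = l" using that by auto
    then show ?thesis using x[of "l - 2"] False by (simp add: weight_def)
  next
    case True
    let ?A = "{m \<in> {1..d + 2}. odd m = odd l}"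
    have l: "l \<in> {1, 2}" using True that by auto
    have "(\<Sum>m \<in> ?A - {l}. weight m x) = (\<Sum>m \<in> ?A - {l}. f m)"
    proof (rule sum.cong[OF refl])
      fix m assume m: "m \<in> ?A - {l}"
      have "m \<noteq> 1" "m \<noteq> 2" using m l by auto
      then have "\<not> m \<le> 2" "m - 2 \<in> {1..d}" "m - 2 + 2 = m" using m by auto
      then show "weight m x = f m" using x[of "m - 2"] by (simp add: weight_def)
    qed
    moreover have "sum (\<lambda>m. weight m x) ?A = sum f ?A" by (rule trans[OF sum_class[OF l] f_sum[OF l, symmetric]])
    moreover have "l \<in> ?A" "finite ?A" using that by auto
    ultimately show ?thesis
      using sum.remove[of ?A l "\<lambda>m. weight m x"] sum.remove[of ?A l f] by simp
  qed
  then show ?thesis by (rule that)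
qed

text \<open>This witness serves three times: for injectivity of \<open>half\<close>, for minimality
  in the facet criterion, and for irredundancy of the inequalities.\<close>

lemma violates_only:
  assumes "p \<in> pairs"
  obtains x where "x \<notin> half p" "\<And>q. q \<in> pairs \<Longrightarrow> q \<noteq> p \<Longrightarrow> x \<in> half q"
proof -
  obtain i j where p: "p = (i, j)" by force
  have ij: "i \<in> {1..d + 2}" "odd i" "j \<in> {1..d + 2}" "even j"
    using assms by (auto simp: pairs_def p)
  \<comment> \<open>weights \<open>-1\<close> at \<open>i\<close>, \<open>j\<close> and \<open>c\<close> elsewhere; \<open>c\<close> is dictated by the sum over a parity class\<close>
  define c where "c = (real d + 4) / real d"
  \<comment> \<open>A pair sharing just one index with \<open>p\<close> has weight sum
    \<open>c - 1\<close>, which is therefore positive.\<close>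
  have c: "c > 1" using d_ge by (simp add: c_def)
  define f where "f l = (if l = i \<or> l = j then -1 else c)" for l
  have f_sum: "(\<Sum>l \<in> {l \<in> {1..d + 2}. odd l = odd m}. f l) = (real d + 2) / 2" (is "sum f ?A = _")
    if "m \<in> {1, 2}" for m :: nat
  proof -
    define a where "a = (if m = 1 then i else j)"
    have a: "a \<in> ?A" using that ij by (auto simp: a_def)
    have "sum f ?A = f a + sum f (?A - {a})" using a by (intro sum.remove) auto
    also have "sum f (?A - {a}) = sum (\<lambda>_. c) (?A - {a})"
      by (intro sum.cong) (use that ij in \<open>auto simp: f_def a_def split: if_splits\<close>)
    also have "\<dots> = real (card ?A - 1) * c" using a by simp
    also have "card ?A = (d + 2) div 2" using card_parity_class that by auto
    also have "real ((d + 2) div 2 - 1) = real d / 2" using d_even by (simp add: real_of_nat_div)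
    also have "f a = -1" by (auto simp: f_def a_def)
    also have "real d / 2 * c = (real d + 4) / 2" using d_ge by (simp add: c_def)
    finally show ?thesis by (simp add: field_simps)
  qed
  obtain x where w: "\<And>l. l \<in> {1..d + 2} \<Longrightarrow> weight l x = f l"
    using obtain_weights[OF f_sum] by blast
  show ?thesis
  proof
    show "x \<notin> half p" using ij by (simp add: half_def p w f_def)
    fix q assume q: "q \<in> pairs" "q \<noteq> p"
    then obtain a b where q: "q = (a, b)" "a \<in> {1..d + 2}" "odd a" "b \<in> {1..d + 2}" "even b"
        "a \<noteq> i \<or> b \<noteq> j"
      by (auto simp: pairs_def p)
    then have "a \<noteq> j" "b \<noteq> i" using ij by auto
    then show "x \<in> half q" using q(6) c w[OF q(2)] w[OF q(4)] by (auto simp: half_def q(1) f_def)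
  qed
qed

section \<open>Full dimension and the facets\<close>

lemma inj_half: "inj_on half pairs"
  by (rule inj_onI) (metis violates_only)

text \<open>The point with all weights \<open>1\<close>, the barycentre of the columns, satisfies
  every inequality strictly and so is an interior point.\<close>

lemma affine_hull_polytope: "affine hull laplacian_polytope d ix = UNIV"
proof -
  have "real ((d + 2) div 2) = (real d + 2) / 2" using d_even by (simp add: real_of_nat_div)
  then have "(\<Sum>l \<in> {l \<in> {1..d + 2}. odd l = odd m}. 1) = (real d + 2) / 2" if "m \<in> {1, 2}" for m :: nat
    using that card_parity_class by auto
  then obtain x where w: "\<And>l. l \<in> {1..d + 2} \<Longrightarrow> weight l x = 1"
    using obtain_weights[of "\<lambda>_. 1"] by blast
  let ?U = "\<Inter>p\<in>pairs. {x. - (grad (fst p) + grad (snd p)) \<bullet> x < weight (fst p) 0 + weight (snd p) 0}"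
  have "open ?U" using finite_pairs by (intro open_INT) (auto intro: open_halfspace_lt)
  moreover have "?U \<subseteq> laplacian_polytope d ix"
    unfolding polytope_eq half_eq by (fastforce intro: less_imp_le)
  moreover have "x \<in> ?U"
  proof (rule INT_I)
    fix p assume "p \<in> pairs"
    then have "0 < weight (fst p) x + weight (snd p) x"
      by (auto simp: pairs_def w)
    then show "x \<in> {x. - (grad (fst p) + grad (snd p)) \<bullet> x < weight (fst p) 0 + weight (snd p) 0}"
      using weight_sum_eq[of "fst p" x "snd p"] unfolding mem_Collect_eq inner_minus_left by linarith
  qed
  ultimately show ?thesis
    using affine_hull_nonempty_interior interior_maximal by blast
qed

definition facet :: "nat \<times> nat \<Rightarrow> (real ^ 'n) set" where
  "facet p = laplacian_polytope d ix \<inter> {x. weight (fst p) x + weight (snd p) x = 0}"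

text \<open>In an irredundant half-space description the facets are exactly the intersections with
  the bounding hyperplanes.\<close>

lemma facet_of_iff: "C facet_of laplacian_polytope d ix \<longleftrightarrow> C \<in> facet ` pairs"
proof -
  \<comment> \<open>\<open>facet_of_polyhedron_explicit\<close> takes normal vector and offset as
    functions of the half-space, so the pair has to be recovered from it.\<close>
  define lab where "lab h = inv_into pairs half h" for h
  have lab: "lab (half p) = p" if "p \<in> pairs" for p
    using that inj_half by (simp add: lab_def)
  let ?a = "\<lambda>h. - (grad (fst (lab h)) + grad (snd (lab h)))"
  let ?b = "\<lambda>h. weight (fst (lab h)) 0 + weight (snd (lab h)) 0"
  let ?S = "laplacian_polytope d ix"
  have S: "?S \<noteq> {}" by (auto simp: laplacian_polytope_def)
  have eq: "{x. ?a (half p) \<bullet> x = ?b (half p)} = {x. weight (fst p) x + weight (snd p) x = 0}"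
    if "p \<in> pairs" for p
  proof (rule set_eqI)
    fix x
    show "x \<in> {x. ?a (half p) \<bullet> x = ?b (half p)}
        \<longleftrightarrow> x \<in> {x. weight (fst p) x + weight (snd p) x = 0}"
      using weight_sum_eq[of "fst p" x "snd p"]
      unfolding lab[OF that] mem_Collect_eq inner_minus_left by linarith
  qed
  have "C facet_of ?S \<longleftrightarrow> (\<exists>h. h \<in> half ` pairs \<and> C = ?S \<inter> {x. ?a h \<bullet> x = ?b h})"
  proof (rule facet_of_polyhedron_explicit)
    show "finite (half ` pairs)" using finite_pairs by simp
    show "?S = affine hull ?S \<inter> \<Inter> (half ` pairs)"
      by (simp add: affine_hull_polytope) (simp add: polytope_eq)
    fix h assume "h \<in> half ` pairs"
    then obtain p where p: "p \<in> pairs" "h = half p" by auto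
    have h: "h = {x. ?a h \<bullet> x \<le> ?b h}" unfolding p lab[OF p(1)] by (rule half_eq)
    moreover have "?a h \<noteq> 0"
    \<comment> \<open>With zero normal, \<open>h\<close> would be empty or the whole space. The
      nonempty polytope inside \<open>h\<close> excludes the former, a violating point the
      latter.\<close>
    proof
      assume "?a h = 0"
      then have "h = {x. 0 \<le> ?b h}" using h by (metis (no_types, lifting) Collect_cong inner_zero_left)
      then have "h = {} \<or> h = UNIV" by (cases "0 \<le> ?b h") simp_all
      moreover have "h \<noteq> {}" using S p polytope_eq by auto
      moreover have "h \<noteq> UNIV" using violates_only[OF p(1)] p by (metis UNIV_I)
      ultimately show False by blast
    qed
    ultimately show "?a h \<noteq> 0 \<and> h = {x. ?a h \<bullet> x \<le> ?b h}" by blast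
  next
    fix F' assume F': "F' \<subset> half ` pairs"
    then obtain p where p: "p \<in> pairs" "half p \<notin> F'" by auto
    obtain x where x: "x \<notin> half p" "\<And>q. q \<in> pairs \<Longrightarrow> q \<noteq> p \<Longrightarrow> x \<in> half q"
      using violates_only[OF p(1)] by blast
    have "x \<in> \<Inter> F'" using x p F' by blast
    moreover have "x \<notin> ?S" using x p polytope_eq by auto
    moreover have "?S \<subseteq> \<Inter> F'" using F' polytope_eq by auto
    ultimately show "?S \<subset> affine hull ?S \<inter> \<Inter> F'" unfolding affine_hull_polytope by blast
  qed
  also have "\<dots> \<longleftrightarrow> C \<in> facet ` pairs"
    using eq by (auto simp: facet_def)
  finally show ?thesis .
qed

text \<open>A facet determines the two columns it misses, and parity tells which of them comes first
  in the pair.\<close>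

lemma inj_facet: "inj_on facet pairs"
proof (rule inj_onI)
  fix p q assume pq: "p \<in> pairs" "q \<in> pairs" "facet p = facet q"
  have *: "{l \<in> {1..d + 2}. col l \<notin> facet r} = {fst r, snd r}" if "r \<in> pairs" for r
  proof -
    have "col l \<in> laplacian_polytope d ix" if "l \<in> {1..d + 2}" for l
      unfolding laplacian_polytope_def using that by (auto intro: hull_inc)
    then show ?thesis
      using weight_sum_col[OF that] that unfolding facet_def pairs_def by (auto split: if_splits)
  qed
  have "{fst p, snd p} = {fst q, snd q}" using *[OF pq(1)] *[OF pq(2)] pq(3) by simp
  then show "p = q" using pq(1,2) by (auto simp: pairs_def doubleton_eq_iff)
qed

lemma card_facets: "card {F. F facet_of laplacian_polytope d ix} = card pairs"
  unfolding facet_of_iff using card_image[OF inj_facet] by simp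

section \<open>Matching the labelled inequalities with the pairs\<close>

text \<open>Components \<open>1\<close> and \<open>2\<close> stand for the odd and even coordinate
  sums, \<open>k + 2\<close> for the coordinate \<open>k\<close>. The case split puts the odd index
  first.\<close>

fun pair_of :: "ineq \<Rightarrow> nat \<times> nat" where
  "pair_of Total = (1, 2)"
| "pair_of (OddSum i) = (1, i + 2)"
| "pair_of (EvenSum j) = (j + 2, 2)"
| "pair_of (PairSum i j) = (if odd i then (i + 2, j + 2) else (j + 2, i + 2))"

lemma pair_of_image: "pair_of ` ineqs d = pairs"
proof (intro equalityI subsetI)
  fix p assume "p \<in> pair_of ` ineqs d"
  then show "p \<in> pairs" by (auto simp: ineqs_def pairs_def)
next
  fix p assume "p \<in> pairs"
  then obtain i j where p: "p = (i, j)" "i \<in> {1..d + 2}" "odd i" "j \<in> {1..d + 2}" "even j"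
    by (auto simp: pairs_def)
  have shift: "\<exists>k\<in>{1..d}. l = k + 2 \<and> even k = even l" if "l \<in> {1..d + 2}" "l \<noteq> 1" "l \<noteq> 2" for l
    using that by (intro bexI[of _ "l - 2"]) auto
  have "i \<noteq> 2" "j \<noteq> 1" using p by auto
  then have i: "i = 1 \<or> (\<exists>k \<in> {1..d}. odd k \<and> i = k + 2)"
    and j: "j = 2 \<or> (\<exists>k \<in> {1..d}. even k \<and> j = k + 2)"
    using shift[OF p(2)] shift[OF p(4)] p(3,5) by blast+
  show "p \<in> pair_of ` ineqs d"
  proof -
    consider "i = 1" "j = 2"
      | l where "i = 1" "l \<in> {1..d}" "even l" "j = l + 2"
      | k where "k \<in> {1..d}" "odd k" "i = k + 2" "j = 2"
      | k l where "k \<in> {1..d}" "odd k" "i = k + 2" "l \<in> {1..d}" "even l" "j = l + 2"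
      using i j by blast
    then show ?thesis
    proof cases
      case 1
      then have "p = pair_of Total" "Total \<in> ineqs d" by (auto simp: p ineqs_def)
      then show ?thesis by blast
    next
      case 2
      then have "p = pair_of (OddSum l)" "OddSum l \<in> ineqs d" by (auto simp: p ineqs_def)
      then show ?thesis by blast
    next
      case 3
      then have "p = pair_of (EvenSum k)" "EvenSum k \<in> ineqs d" by (auto simp: p ineqs_def)
      then show ?thesis by blast
    next
      case 4
      \<comment> \<open>\<open>PairSum\<close> labels carry increasing indices, whereas pairs are
        ordered by parity.\<close>
      then have "k < l \<or> l < k" by (metis linorder_neqE_nat)
      with 4 have "p = pair_of (PairSum (min k l) (max k l))" "PairSum (min k l) (max k l) \<in> ineqs d"
        by (auto simp: p ineqs_def min_def max_def)
      then show ?thesis by blast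
    qed
  qed
qed

text \<open>Ensures that removing one label really removes its half-space. The condition
  \<open>i < j\<close> keeps a \<open>PairSum\<close> from occurring under two labels.\<close>

lemma inj_pair_of: "inj_on pair_of (ineqs d)"
  by (rule inj_onI) (auto simp: ineqs_def split: if_splits)

lemma satisfies_iff:
  assumes "c \<in> ineqs d"
  shows "satisfies d ix x c \<longleftrightarrow> x \<in> half (pair_of c)"
proof (cases c)
  case Total
  have "(\<Sum>k = 1..d. x $ ix k) = (\<Sum>k \<in> {k \<in> {1..d}. odd k = odd (1::nat)}. x $ ix k)
      + (\<Sum>k \<in> {k \<in> {1..d}. odd k = odd (2::nat)}. x $ ix k)" by (rule sum_split_parity)
  then show ?thesis by (auto simp: Total half_def weight_def)
next
  case (OddSum i)
  with assms show ?thesis by (auto simp: half_def ineqs_def weight_def field_simps)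
next
  case (EvenSum j)
  with assms show ?thesis by (auto simp: half_def ineqs_def weight_def field_simps)
next
  case (PairSum i j)
  with assms show ?thesis by (auto simp: half_def ineqs_def weight_def add.commute)
qed

lemma solutions_eq:
  assumes "C \<subseteq> ineqs d"
  shows "solutions d ix C = (\<Inter>p \<in> pair_of ` C. half p)"
  using assms satisfies_iff by (auto simp: solutions_def)

lemma polytope_eq_solutions: "laplacian_polytope d ix = solutions d ix (ineqs d)"
  using solutions_eq[of "ineqs d"] by (simp add: pair_of_image polytope_eq)

text \<open>The point violating only the half-space of \<open>c\<close> satisfies all other labels,
  since these belong to other pairs.\<close>

lemma irredundant:
  assumes "c \<in> ineqs d"
  shows "laplacian_polytope d ix \<subset> solutions d ix (ineqs d - {c})"
proof
  show "laplacian_polytope d ix \<subseteq> solutions d ix (ineqs d - {c})"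
    unfolding polytope_eq_solutions by (auto simp: solutions_def)
  have c: "pair_of c \<in> pairs" using assms pair_of_image by blast
  obtain x where x: "x \<notin> half (pair_of c)"
      "\<And>q. q \<in> pairs \<Longrightarrow> q \<noteq> pair_of c \<Longrightarrow> x \<in> half q"
    using violates_only[OF c] by blast
  have "x \<in> half (pair_of c')" if "c' \<in> ineqs d - {c}" for c'
    using that assms inj_pair_of pair_of_image by (intro x) (auto simp: inj_on_def)
  then have "x \<in> solutions d ix (ineqs d - {c})" by (auto simp: solutions_eq)
  moreover have "x \<notin> laplacian_polytope d ix" using x c by (auto simp: polytope_eq)
  ultimately show "laplacian_polytope d ix \<noteq> solutions d ix (ineqs d - {c})" by blast
qed

end

theorem theorem5p3:
  fixes d :: nat and ix :: "nat \<Rightarrow> 'n::finite"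
  assumes "d \<ge> 2" and "even d"
    and "bij_betw ix {1..d} (UNIV :: 'n set)"
  shows "laplacian_polytope d ix =
     {x :: real ^ 'n. (\<Sum>k = 1..d. x $ ix k) \<le> real d + 2
       \<and> (\<forall>i \<in> {1..d}. even i \<longrightarrow>
            (\<Sum>k \<in> {k \<in> {1..d}. odd k}. x $ ix k) - x $ ix i \<le> (real d + 2) / 2)
       \<and> (\<forall>j \<in> {1..d}. odd j \<longrightarrow>
            (\<Sum>k \<in> {k \<in> {1..d}. even k}. x $ ix k) - x $ ix j \<le> (real d + 2) / 2)
       \<and> (\<forall>i j. 1 \<le> i \<and> i < j \<and> j \<le> d \<and> odd (i + j) \<longrightarrow> 0 \<le> x $ ix i + x $ ix j)}
   \<and> (\<forall>c \<in> ineqs d. laplacian_polytope d ix \<subset> solutions d ix (ineqs d - {c}))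
   \<and> real (card {F. F facet_of laplacian_polytope d ix}) = (real d + 2)^2 / 4"
proof -
  interpret numbered_space d ix using assms by unfold_locales
  show ?thesis
    unfolding solutions_ineqs[symmetric] card_facets
    using polytope_eq_solutions irredundant card_pairs by blast
qed

end
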